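(* Let $\mathfrak A\in X$ and set $$p(n,\mathfrak A):=\#\{\mathfrak B\in X:\ T_\omega(\mathfrak B)=\mathfrak A \text{ for some } \omega\in\mathbb F_2^+ \text{ with } |\omega|=n\}.$$ Then for every $n$, $p(n,\mathfrak A)\le 3^n$.
   Context: $\mathbb F_2^+$ is the free monoid of finite words over $\{a,b\}$, with identity $e$ and length $|\cdot|$. A tree is a map $\mathfrak A:\mathbb F_2^+\to\{0,1\}$, $\omega\mapsto\mathfrak A_\omega$; its root is $\mathfrak A_e$. The distance between two distinct trees is $2^{-N}$, where $N$ is the minimal length of a word $\omega$ with $\mathfrak A_\omega\ne\mathfrak B_\omega$. The action is $(T_a\mathfrak A)_x=\mathfrak A_{ax}$, $(T_b\mathfrak A)_x=\mathfrak A_{bx}$, and $T_\omega=T_{\omega_1}\circ\cdots\circ T_{\omega_n}$ for $\omega=\omega_1\ldots\omega_n$ ($T_e$ is the identity). For $i\in\{0,1\}$ and trees $\mathfrak A,\mathfrak B$, $i[\mathfrak A,\mathfrak B]$ denotes the tree $\mathfrak C$ with $\mathfrak C_e=i$, $T_a\mathfrak C=\mathfrak A$, $T_b\mathfrak C=\mathfrak B$. $H$ is the map on trees determined recursively by $H(i[\mathfrak A,\mathfrak B]) = i\big[1[H(\mathfrak B),H(\mathfrak B)],0[H(\mathfrak A),H(\mathfrak B)]\big]$, $i\in\{0,1\}$. $\mathfrak J$ is the unique fixed point of $H$ with root $0$, and $X=\overline{\{T_\omega(\mathfrak J):\omega\in\mathbb F_2^+\}}$ is the closure of its orbit. *)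

theory Defs
  imports "HOL-Analysis.Abstract_Metric_Spaces" "HOL-Library.Z2"
begin

datatype letter = La | Lb

type_synonym word = "letter list"

type_synonym tree = "word \<Rightarrow> bit"

definition shift :: "letter \<Rightarrow> tree \<Rightarrow> tree" where
  "shift l A = (\<lambda>x. A (l # x))"

text \<open>
  The action composes as \<open>T (u @ v) = T u \<circ> T v\<close>. Since \<open>shift\<close> reads a letter at the root,
  this makes \<open>T w A x = A (rev w @ x)\<close>, with \<open>w\<close> reversed.
\<close>
primrec T :: "word \<Rightarrow> tree \<Rightarrow> tree" where
  "T [] A = A"
| "T (l # w) A = shift l (T w A)"

definition node :: "bit \<Rightarrow> tree \<Rightarrow> tree \<Rightarrow> tree" where
  "node i A B = (\<lambda>w. case w of [] \<Rightarrow> i | l # x \<Rightarrow> (case l of La \<Rightarrow> A x | Lb \<Rightarrow> B x))"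

lemma node_simps [simp]:
  "node i A B [] = i" "shift La (node i A B) = A" "shift Lb (node i A B) = B"
  by (simp_all add: node_def shift_def)

lemma node_app [simp]: "node i A B (La # x) = A x" "node i A B (Lb # x) = B x"
  by (simp_all add: node_def)

lemma node_collapse: "node (C []) (shift La C) (shift Lb C) = C"
proof
  fix w show "node (C []) (shift La C) (shift Lb C) w = C w"
    by (auto simp: node_def shift_def split: list.split letter.split)
qed

definition tree_dist :: "tree \<Rightarrow> tree \<Rightarrow> real" where
  "tree_dist A B =
    (if A = B then 0 else (1/2) ^ (LEAST N. \<exists>w. length w = N \<and> A w \<noteq> B w))"

lemma tree_dist_less_iff:
  "tree_dist A B < (1/2) ^ n \<longleftrightarrow> (\<forall>w. length w \<le> n \<longrightarrow> A w = B w)"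
proof (cases "A = B")
  case False
  let ?P = "\<lambda>N. \<exists>w. length w = N \<and> A w \<noteq> B w"
  from False have ex: "\<exists>N. ?P N" by (auto simp: fun_eq_iff)
  have "tree_dist A B < (1/2) ^ n \<longleftrightarrow> n < (LEAST N. ?P N)"
    using False by (simp add: tree_dist_def power_strict_decreasing_iff)
  also have "\<dots> \<longleftrightarrow> (\<forall>w. length w \<le> n \<longrightarrow> A w = B w)"
    using LeastI_ex[OF ex] not_less_Least[of _ ?P]
    by (metis (mono_tags, lifting) le_less_trans not_le)
  finally show ?thesis .
qed (simp add: tree_dist_def)

interpretation tree: Metric_space UNIV tree_dist
proof
  fix A B C :: tree
  show "0 \<le> tree_dist A B" by (simp add: tree_dist_def)
  show "tree_dist A B = tree_dist B A"
    unfolding tree_dist_def by (simp only: eq_commute[of A B] eq_commute[of "A _" "B _"])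
  show "tree_dist A B = 0 \<longleftrightarrow> A = B" by (simp add: tree_dist_def)
  show "tree_dist A C \<le> tree_dist A B + tree_dist B C"
  proof (cases "A = C")
    case False
    then obtain n where n: "tree_dist A C = (1/2) ^ n"
      by (auto simp: tree_dist_def)
    then have "\<not> tree_dist A C < (1/2) ^ n" by simp
    then have "\<not> tree_dist A B < (1/2) ^ n \<or> \<not> tree_dist B C < (1/2) ^ n"
      unfolding tree_dist_less_iff by metis
    moreover have "0 \<le> tree_dist A B" "0 \<le> tree_dist B C"
      by (simp_all add: tree_dist_def)
    ultimately show ?thesis using n by linarith
  qed (simp add: tree_dist_def)
qed

fun H :: "tree \<Rightarrow> tree" where
  "H C [] = C []"
| "H C [La] = 1"
| "H C [Lb] = 0"
| "H C (La # La # x) = H (shift Lb C) x"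
| "H C (La # Lb # x) = H (shift Lb C) x"
| "H C (Lb # La # x) = H (shift La C) x"
| "H C (Lb # Lb # x) = H (shift Lb C) x"

lemma H_node: "H (node i A B) = node i (node 1 (H B) (H B)) (node 0 (H A) (H B))"
proof
  fix w show "H (node i A B) w = node i (node 1 (H B) (H B)) (node 0 (H A) (H B)) w"
    by (cases "(node i A B, w)" rule: H.cases) simp_all
qed

lemma H_unique:
  assumes F: "\<And>i A B. F (node i A B) = node i (node 1 (F B) (F B)) (node 0 (F A) (F B))"
  shows "F = H"
proof -
  have F': "F C = node (C []) (node 1 (F (shift Lb C)) (F (shift Lb C)))
      (node 0 (F (shift La C)) (F (shift Lb C)))" for C
    using F[of "C []" "shift La C" "shift Lb C"] by (simp add: node_collapse)
  have "F C w = H C w" for C w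
  proof (induction C w rule: H.induct)
  qed (subst F', simp)+
  then show ?thesis by (intro ext)
qed

definition J :: tree where
  "J = (THE A. H A = A \<and> A [] = 0)"

text \<open>
  The tree at an even-length word is read at a word of half the length, which is how the fixed
  point is constructed below.
\<close>
fun half :: "word \<Rightarrow> word" where
  "half (La # La # x) = Lb # half x"
| "half (La # Lb # x) = Lb # half x"
| "half (Lb # La # x) = La # half x"
| "half (Lb # Lb # x) = Lb # half x"
| "half _ = []"

lemma length_half: "length (half w) = length w div 2"
  by (induction w rule: half.induct) simp_all

lemma H_eq:
  "H C w = (if even (length w) then C (half w) else if last w = La then 1 else 0)"
  by (induction C w rule: H.induct) (auto simp: shift_def)

function Jrec :: tree where
  "Jrec w = (if w = [] then 0 else if even (length w) then Jrec (half w)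
             else if last w = La then 1 else 0)"
  by auto
termination by (relation "measure length") (auto simp: length_half)

declare Jrec.simps [simp del]

lemma ex1_fixpoint: "\<exists>!A. H A = A \<and> A [] = 0"
proof (rule ex1I[of _ Jrec])
  show "H Jrec = Jrec \<and> Jrec [] = 0"
    by (auto simp: fun_eq_iff H_eq Jrec.simps[of "_ :: word"])
next
  fix A assume A: "H A = A \<and> A [] = 0"
  have "A w = Jrec w" for w
  proof (induction w rule: Jrec.induct)
    case (1 w)
    have "A w = (if even (length w) then A (half w) else if last w = La then 1 else 0)"
      using H_eq[of A w] conjunct1[OF A] by metis
    with 1 conjunct2[OF A] show ?case
      by (cases "w = []"; cases "even (length w)") (simp_all add: Jrec.simps[of w] Jrec.simps[of "[]"])
  qed
  then show "A = Jrec" by (intro ext)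
qed

lemma J_fixpoint: "H J = J" and J_root: "J [] = 0"
  using theI'[OF ex1_fixpoint] by (simp_all add: J_def)

definition X :: "tree set" where
  "X = tree.mtopology closure_of (range (\<lambda>w. T w J))"

definition preimages :: "nat \<Rightarrow> tree \<Rightarrow> tree set" where
  "preimages n A = {B \<in> X. \<exists>w. length w = n \<and> T w B = A}"

text \<open>
  As \<open>card\<close> of an infinite set is \<open>0\<close>, a bound on \<open>p\<close> says something only together with
  finiteness of \<open>preimages\<close>.
\<close>
definition p :: "nat \<Rightarrow> tree \<Rightarrow> nat" where
  "p n A = card (preimages n A)"

end

theory Submission
  imports Defs
begin

text \<open>
  Every shift of a tree in \<open>X\<close> is in \<open>X\<close>, so it is enough to show that a tree \<open>A\<close> has at most
  three parents in \<open>X\<close>, that is, at most three \<open>B \<in> X\<close> of which \<open>A\<close> is a child; iterating \<open>n\<close> times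
  gives \<open>3 ^ n\<close>.

  The tree \<open>J\<close> is fixed by the substitution \<open>H\<close>, which expands one level into two. Cutting \<open>J\<close> at an
  even level therefore gives \<open>H C\<close>, and cutting it at an odd level gives a child of \<open>H C\<close>, with \<open>C\<close> in
  the orbit again. In the limit a tree of \<open>X\<close> is either \<open>H C\<close> or a node whose two children are
  images under \<open>H\<close>, and these cases exclude each other (\<open>H_neq_node_H\<close>): the parity of the cut can be
  read off the tree, and \<open>H\<close> is injective. This turns questions about \<open>A\<close> into questions about a
  desubstituted tree.

  If \<open>A = H C\<close>, its parents are among \<open>1[A, A]\<close> and the trees \<open>0[H F, H G]\<close> where \<open>F, G\<close> are siblings in \<open>X\<close>
  and one of them is \<open>C\<close>. If \<open>A\<close> is not an image of \<open>H\<close>, its parents are images under \<open>H\<close>, hence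
  either determined by \<open>A\<close> up to the root, or the images of trees in \<open>X\<close> whose right child is a
  given tree, for which the bound is already known. So all rests on
  \<open>card_pairs_with\<close>: a tree \<open>C\<close> occurs in at most two sibling pairs. Siblings in \<open>X\<close> are
  also desubstituted in three ways, \<open>(1[H G, H G], 0[H F, H G])\<close>, \<open>(H D, H D)\<close> and \<open>(H F, H G)\<close>, so a
  descent should lead to trees where the bound is evident. Two points need care.

  First, a pair \<open>(H D, H D)\<close> might be new at each step of the descent. It arises only if \<open>D\<close> is a limit
  of right children, and for such \<open>D\<close> the pair \<open>(D, D)\<close> is counted from the outset.

  Second, a tree may be desubstituted for ever, as \<open>J\<close> is. So the induction is on the
  level up to which pairs are compared: among any three sibling pairs containing \<open>C\<close>, two
  agree up to level \<open>n\<close>. Each substitution gains a level, and the induction is anchored at the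
  roots of the siblings, where one uses that no tree in \<open>X\<close> has a left child with root \<open>0\<close> and a right
  child with root \<open>1\<close> (\<open>pair_limits_children\<close>).
\<close>

section \<open>Agreement up to a level, and limits of sets of trees\<close>

definition agree :: "nat \<Rightarrow> tree \<Rightarrow> tree \<Rightarrow> bool" where
  "agree n A B \<longleftrightarrow> (\<forall>w. length w \<le> n \<longrightarrow> A w = B w)"

definition limits :: "tree set \<Rightarrow> tree set" where
  "limits S = {B. \<forall>n. \<exists>C\<in>S. agree n B C}"

lemma agree_refl [simp]: "agree n A A"
  by (simp add: agree_def)

lemma agree_mono: "agree n A B \<Longrightarrow> m \<le> n \<Longrightarrow> agree m A B"
  by (simp add: agree_def)

lemma agree_SucD: "agree (Suc n) A B \<Longrightarrow> agree n A B"
  by (simp add: agree_def)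

lemma tree_eqI_agree: "(\<And>n. agree n A B) \<Longrightarrow> A = B"
  by (auto simp: agree_def)

lemma agree_shift: "agree (Suc n) A B \<Longrightarrow> agree n (shift l A) (shift l B)"
  by (simp add: agree_def shift_def)

lemma agree_node:
  assumes "agree n A A'" "agree n B B'"
  shows "agree (Suc n) (node i A B) (node i A' B')"
  unfolding agree_def
proof (intro allI impI)
  fix w :: word
  assume "length w \<le> Suc n"
  with assms show "node i A B w = node i A' B' w"
    by (auto simp: node_def agree_def split: list.split letter.split)
qed

lemma limits_mono: "S \<subseteq> S' \<Longrightarrow> limits S \<subseteq> limits S'"
  unfolding limits_def by blast

lemma limits_Un: "limits (S \<union> S') \<subseteq> limits S \<union> limits S'"
proof
  fix B
  assume B: "B \<in> limits (S \<union> S')"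
  show "B \<in> limits S \<union> limits S'"
  proof (rule ccontr)
    assume "B \<notin> limits S \<union> limits S'"
    then obtain m n where m: "\<And>C. C \<in> S \<Longrightarrow> \<not> agree m B C"
      and n: "\<And>C. C \<in> S' \<Longrightarrow> \<not> agree n B C"
      by (auto simp: limits_def)
    obtain C where "C \<in> S \<union> S'" "agree (max m n) B C"
      using B unfolding limits_def by blast
    then have "agree m B C" "agree n B C" by (auto elim: agree_mono)
    with m n \<open>C \<in> S \<union> S'\<close> show False by blast
  qed
qed

lemma limits_image:
  assumes f: "\<And>n. \<exists>m. \<forall>A B. agree m A B \<longrightarrow> agree n (f A) (f B)"
  shows "f ` limits S \<subseteq> limits (f ` S)"
proof
  fix B
  assume "B \<in> f ` limits S"
  then obtain A where A: "A \<in> limits S" "B = f A" by blast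
  show "B \<in> limits (f ` S)"
    unfolding limits_def
  proof (intro CollectI allI)
    fix n
    obtain m where "\<forall>A B. agree m A B \<longrightarrow> agree n (f A) (f B)" using f by blast
    moreover obtain C where "C \<in> S" "agree m A C" using A(1) unfolding limits_def by blast
    ultimately show "\<exists>C\<in>f ` S. agree n B C" using A(2) by blast
  qed
qed

text \<open>
  Limits of substituted trees have to be substituted trees again. They are,
  because each of the maps in question has a continuous left inverse, which carries an
  approximation of the limit back to an approximation of its preimage.
\<close>
lemma limits_of_image:
  assumes f: "\<And>n A B. agree n A B \<Longrightarrow> agree n (f A) (f B)"
    and g: "\<And>n. \<exists>m. \<forall>A B. agree m A B \<longrightarrow> agree n (g A) (g B)"
    and gf: "\<And>A. A \<in> S \<Longrightarrow> g (f A) = A"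
  shows "limits (f ` S) \<subseteq> f ` limits S"
proof
  fix B
  assume B: "B \<in> limits (f ` S)"
  have approx: "\<exists>A\<in>S. agree n B (f A) \<and> agree n (g B) A" for n
  proof -
    obtain m where m: "\<forall>A B. agree m A B \<longrightarrow> agree n (g A) (g B)" using g by blast
    obtain A where "A \<in> S" "agree (max m n) B (f A)"
      using B unfolding limits_def by blast
    then have "A \<in> S" "agree n B (f A)" "agree m B (f A)"
      by (auto elim: agree_mono)
    moreover from \<open>agree m B (f A)\<close> have "agree n (g B) (g (f A))" using m by simp
    ultimately show ?thesis using gf[OF \<open>A \<in> S\<close>] by auto
  qed
  have "B = f (g B)"
  proof (rule tree_eqI_agree)
    fix n
    obtain A where A: "agree n B (f A)" "agree n (g B) A" using approx[of n] by blast
    from f[OF A(2)] A(1) show "agree n B (f (g B))" by (simp add: agree_def)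
  qed
  moreover have "g B \<in> limits S"
    unfolding limits_def using approx by (intro CollectI allI) blast
  ultimately show "B \<in> f ` limits S" by (rule image_eqI)
qed

lemma limits_Un3:
  assumes "S \<subseteq> A \<union> (B \<union> C)" "limits A \<subseteq> A'" "limits B \<subseteq> B'" "limits C \<subseteq> C'"
  shows "limits S \<subseteq> A' \<union> (B' \<union> C')"
  using limits_mono[OF assms(1)] limits_Un[of A "B \<union> C"] limits_Un[of B C] assms(2-) by blast

section \<open>The substitution\<close>

lemma H_shift [simp]:
  "shift La (H C) = node 1 (H (shift Lb C)) (H (shift Lb C))"
  "shift Lb (H C) = node 0 (H (shift La C)) (H (shift Lb C))"
  using H_node[of "C []" "shift La C" "shift Lb C"] by (simp_all add: node_collapse)

lemma agree_H: "agree n A B \<Longrightarrow> agree (Suc n) (H A) (H B)"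
  by (auto simp: agree_def H_eq length_half)

text \<open>
  A section of \<^const>\<open>half\<close>: reading a substituted tree at doubled words recovers
  the original tree, continuously.
\<close>
primrec double :: "word \<Rightarrow> word" where
  "double [] = []"
| "double (l # w) = (case l of La \<Rightarrow> Lb | Lb \<Rightarrow> La) # La # double w"

definition desubstitute :: "tree \<Rightarrow> tree" where
  "desubstitute A = (\<lambda>w. A (double w))"

lemma half_double: "half (double w) = w"
  by (induction w) (auto split: letter.split)

lemma length_double: "length (double w) = 2 * length w"
  by (induction w) auto

lemma desubstitute_H [simp]: "desubstitute (H A) = A"
  by (simp add: desubstitute_def H_eq half_double length_double)

lemma H_inject [simp]: "H A = H B \<longleftrightarrow> A = B"
  by (metis desubstitute_H)

lemma agree_desubstitute: "agree (2 * n) A B \<Longrightarrow> agree n (desubstitute A) (desubstitute B)"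
  by (simp add: agree_def desubstitute_def length_double)

text \<open>
  Recognizability: in \<open>H C\<close> the last letter of a word decides the label at odd levels and is
  irrelevant at level \<open>2\<close>; below a node whose children are images under \<open>H\<close> it
  decides the label at level \<open>2\<close>.
\<close>
lemma H_neq_node_H: "H C \<noteq> node i (H A) (H B)"
proof
  assume eq: "H C = node i (H A) (H B)"
  have "H C [La, La] = H C [La, Lb]" by simp
  then show False unfolding eq by simp
qed

lemmas node_H_neq_H [simp] = H_neq_node_H H_neq_node_H[symmetric]

lemma node_eq_iff [simp]: "node i A B = node j A' B' \<longleftrightarrow> i = j \<and> A = A' \<and> B = B'"
  by (metis node_simps)

text \<open>
  A pair of siblings is encoded as the tree with root \<open>0\<close> and the pair as its children, so that limits of pairs
  are limits of trees.
\<close>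
definition blank :: "tree \<Rightarrow> tree" where
  "blank A = node 0 (shift La A) (shift Lb A)"

text \<open>
  The children of \<open>H C\<close> are \<open>twin 1 (shift Lb C)\<close> and \<open>spread C\<close>, by \<open>H_node\<close>.
\<close>
definition twin :: "bit \<Rightarrow> tree \<Rightarrow> tree" where
  "twin i D = node i (H D) (H D)"

definition spread :: "tree \<Rightarrow> tree" where
  "spread E = node 0 (H (shift La E)) (H (shift Lb E))"

lemma blank_simps [simp]:
  "blank A [] = 0" "shift La (blank A) = shift La A" "shift Lb (blank A) = shift Lb A"
  by (simp_all add: blank_def)

lemma twin_simps [simp]:
  "twin i D [] = i" "shift l (twin i D) = H D"
  by (simp add: twin_def) (cases l; simp add: twin_def)

lemma spread_simps [simp]:
  "spread E [] = 0" "shift l (spread E) = H (shift l E)"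
  by (simp add: spread_def) (cases l; simp add: spread_def)

lemma tree_eqI:
  "A [] = B [] \<Longrightarrow> shift La A = shift La B \<Longrightarrow> shift Lb A = shift Lb B \<Longrightarrow> A = B"
  by (metis node_collapse)

lemma agree_blank: "agree n A B \<Longrightarrow> agree n (blank A) (blank B)"
  unfolding blank_def
  by (cases n) (simp add: agree_def, auto intro: agree_node agree_shift)

lemma agree_twin: "agree n A B \<Longrightarrow> agree n (twin i A) (twin i B)"
  unfolding twin_def by (intro agree_SucD[OF agree_node] agree_SucD[OF agree_H])

text \<open>
  A level is gained only from level \<open>1\<close> on: agreement of the roots says nothing about the
  children, and \<open>spread\<close> depends on these alone.
\<close>
lemma agree_spread:
  assumes "agree (Suc n) A B"
  shows "agree (Suc (Suc n)) (spread A) (spread B)"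
  unfolding spread_def using assms by (intro agree_node agree_H agree_shift)

lemma agree_spread': "agree n A B \<Longrightarrow> agree n (spread A) (spread B)"
  by (cases n) (simp add: agree_def, auto intro: agree_spread agree_SucD)

lemma limits_H: "limits (H ` S) \<subseteq> H ` limits S"
proof (rule limits_of_image[where g = desubstitute])
  show "\<And>n A B. agree n A B \<Longrightarrow> agree n (H A) (H B)"
    by (rule agree_SucD[OF agree_H])
  show "\<exists>m. \<forall>A B. agree m A B \<longrightarrow> agree n (desubstitute A) (desubstitute B)" for n
    using agree_desubstitute by blast
qed simp

lemma limits_twin: "limits (twin i ` S) \<subseteq> twin i ` limits S"
proof (rule limits_of_image[where g = "\<lambda>B. desubstitute (shift La B)"])
  show "\<exists>m. \<forall>A B. agree m A B \<longrightarrow>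
      agree n (desubstitute (shift La A)) (desubstitute (shift La B))" for n
    using agree_desubstitute agree_shift by blast
qed (simp_all add: agree_twin)

lemma limits_spread:
  assumes "\<And>E. E \<in> S \<Longrightarrow> E [] = 0"
  shows "limits (spread ` S) \<subseteq> spread ` limits S"
proof (rule limits_of_image[where
      g = "\<lambda>B. node 0 (desubstitute (shift La B)) (desubstitute (shift Lb B))"])
  show "\<exists>m. \<forall>A B. agree m A B \<longrightarrow>
      agree n (node 0 (desubstitute (shift La A)) (desubstitute (shift Lb A)))
        (node 0 (desubstitute (shift La B)) (desubstitute (shift Lb B)))" for n
    by (intro exI[of _ "Suc (2 * n)"] allI impI agree_SucD[OF agree_node]
        agree_desubstitute agree_shift)
  show "node 0 (desubstitute (shift La (spread E))) (desubstitute (shift Lb (spread E))) = E"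
    if "E \<in> S" for E
    using node_collapse[of E] assms[OF that] by simp
qed (rule agree_spread')

section \<open>The orbit of the fixed point and its limits\<close>

definition subtree :: "word \<Rightarrow> tree" where
  "subtree w = (\<lambda>x. J (w @ x))"

abbreviation orbit :: "tree set" where
  "orbit \<equiv> range subtree"

lemma T_J: "T w J = subtree (rev w)"
  by (induction w) (simp_all add: subtree_def shift_def)

lemma orbit_eq: "range (\<lambda>w. T w J) = orbit"
  unfolding T_J by (metis (no_types) surj_def rev_rev_ident image_image)

lemma X_eq_limits: "X = limits orbit"
proof -
  have "B \<in> X \<longleftrightarrow> (\<forall>r>0. \<exists>C\<in>orbit. tree_dist B C < r)" for B
    by (auto simp: X_def orbit_eq tree.metric_closure_of tree.in_mball)
  moreover have "(\<forall>r>0. \<exists>C\<in>orbit. tree_dist B C < r)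
      \<longleftrightarrow> (\<forall>n. \<exists>C\<in>orbit. tree_dist B C < (1/2) ^ n)" (is "?L \<longleftrightarrow> ?R") for B
  proof
    assume ?R
    show ?L
    proof (intro allI impI)
      fix r :: real
      assume "r > 0"
      then obtain n where "(1/2) ^ n < r"
        using real_arch_pow_inv[of r "1/2"] by auto
      with \<open>?R\<close> show "\<exists>C\<in>orbit. tree_dist B C < r" by (meson less_trans)
    qed
  qed simp
  ultimately show ?thesis
    by (auto simp: limits_def agree_def tree_dist_less_iff)
qed

lemma shift_subtree: "shift l (subtree w) = subtree (w @ [l])"
  by (simp add: shift_def subtree_def)

lemma half_append: "even (length u) \<Longrightarrow> half (u @ x) = half u @ half x"
  by (induction u rule: half.induct) auto

text \<open>
  At the word \<open>w @ x\<close> the equation \<open>J = H J\<close> reads the label at \<open>half w @ half x\<close> or, at odd levels, the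
  last letter, just as \<open>H\<close> does for the subtree at \<open>half w\<close>.
\<close>
lemma subtree_even: "even (length w) \<Longrightarrow> subtree w = H (subtree (half w))"
proof
  fix x
  assume "even (length w)"
  then show "subtree w x = H (subtree (half w)) x"
    using H_eq[of J "w @ x"] half_append[of w x]
    by (cases "x = []") (auto simp: subtree_def H_eq J_fixpoint)
qed

lemma subtree_cases:
  obtains (even) u where "subtree w = H (subtree u)"
  | (odd_a) u where "subtree w = twin 1 (shift Lb (subtree u))"
  | (odd_b) u where "subtree w = spread (subtree u)" "length u < length w"
proof (cases "even (length w)")
  case True
  then show ?thesis using even subtree_even by blast
next
  case False
  then obtain v l where w: "w = v @ [l]" by (cases w rule: rev_cases) auto
  with False have v: "subtree v = H (subtree (half v))" using subtree_even by simp
  show ?thesis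
  proof (cases l)
    case La
    then show ?thesis
      using odd_a[of "half v"] by (simp add: w v shift_subtree[symmetric] twin_def)
  next
    case Lb
    then show ?thesis
      using odd_b[of "half v"]
      by (simp add: w v shift_subtree[symmetric] spread_def length_half)
  qed
qed

definition right_limits :: "tree set" where
  "right_limits = limits (shift Lb ` orbit)"

definition pair_limits :: "tree set" where
  "pair_limits = limits (blank ` orbit)"

lemma shift_in_X: "B \<in> X \<Longrightarrow> shift l B \<in> X"
proof -
  assume "B \<in> X"
  then have "shift l B \<in> limits (shift l ` orbit)"
    using limits_image[of "shift l" orbit] agree_shift unfolding X_eq_limits by blast
  moreover have "shift l ` orbit \<subseteq> orbit" using shift_subtree by auto
  ultimately show ?thesis unfolding X_eq_limits using limits_mono by blast
qed

lemma blank_in_pair_limits: "B \<in> X \<Longrightarrow> blank B \<in> pair_limits"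
  using limits_image[of blank orbit] agree_blank unfolding X_eq_limits pair_limits_def by blast

lemma shift_Lb_in_right_limits:
  assumes "E \<in> pair_limits"
  shows "shift Lb E \<in> right_limits"
proof -
  have "shift Lb E \<in> limits (shift Lb ` blank ` orbit)"
    using assms limits_image[of "shift Lb" "blank ` orbit"] agree_shift unfolding pair_limits_def by blast
  then show ?thesis by (simp add: right_limits_def image_image)
qed

lemma pair_limits_root: "E \<in> pair_limits \<Longrightarrow> E [] = 0"
proof -
  assume "E \<in> pair_limits"
  then obtain C where "agree 0 E (blank C)" unfolding pair_limits_def limits_def by blast
  then show "E [] = 0" by (simp add: agree_def)
qed

text \<open>
  When \<open>B\<close> is a limit of subtrees cut at odd levels, the left child of the trees substituted there
  need not converge in the case \<open>twin\<close>. What survives is the limit \<open>D\<close> of their right children, and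
  \<open>right_limits\<close> and \<open>pair_limits\<close> record exactly what survives in each case.
\<close>
lemma X_decompose:
  assumes "B \<in> X"
  obtains (even) C where "C \<in> X" "B = H C"
  | (twin) D where "D \<in> right_limits" "B = twin 1 D"
  | (spread) E where "E \<in> pair_limits" "B = spread E"
proof -
  have "orbit \<subseteq> H ` orbit \<union> (twin 1 ` shift Lb ` orbit \<union> spread ` blank ` orbit)"
  proof
    fix B
    assume "B \<in> orbit"
    then obtain w where "B = subtree w" by auto
    then show "B \<in> H ` orbit \<union> (twin 1 ` shift Lb ` orbit \<union> spread ` blank ` orbit)"
    proof (cases w rule: subtree_cases)
      case (even u)
      with \<open>B = subtree w\<close> show ?thesis by (metis UnI1 imageI rangeI)
    next
      case (odd_a u)
      with \<open>B = subtree w\<close> show ?thesis by (metis UnI1 UnI2 imageI rangeI)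
    next
      case (odd_b u)
      with \<open>B = subtree w\<close> have "B = spread (blank (subtree u))"
        by (simp add: spread_def)
      then show ?thesis by (metis UnI2 imageI rangeI)
    qed
  qed
  then have "X \<subseteq> H ` X \<union> (twin 1 ` right_limits \<union> spread ` pair_limits)"
    unfolding X_eq_limits right_limits_def pair_limits_def
    by (rule limits_Un3[OF _ limits_H limits_twin limits_spread]) auto
  with assms have "B \<in> H ` X \<union> (twin 1 ` right_limits \<union> spread ` pair_limits)" by (rule subsetD[rotated])
  then show ?thesis by (elim UnE imageE) (rule that; assumption)+
qed

lemma right_limits_decompose:
  assumes "D \<in> right_limits"
  obtains (even) D' where "D' \<in> right_limits" "D = H D'"
  | (spread) E where "E \<in> pair_limits" "D = spread E"
proof -
  have "shift Lb ` orbit \<subseteq> H ` shift Lb ` orbit \<union> (spread ` blank ` orbit \<union> spread ` blank ` orbit)"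
  proof
    fix B
    assume "B \<in> shift Lb ` orbit"
    then obtain w where "B = shift Lb (subtree w)" by auto
    then show "B \<in> H ` shift Lb ` orbit \<union> (spread ` blank ` orbit \<union> spread ` blank ` orbit)"
    proof (cases w rule: subtree_cases)
      case (even u)
      with \<open>B = shift Lb (subtree w)\<close> have "B = spread (blank (subtree u))"
        by (simp add: spread_def)
      then show ?thesis by (metis UnI2 imageI rangeI)
    next
      case (odd_a u)
      with \<open>B = shift Lb (subtree w)\<close> have "B = H (shift Lb (subtree u))" by simp
      then show ?thesis by (metis UnI1 imageI rangeI)
    next
      case (odd_b u)
      with \<open>B = shift Lb (subtree w)\<close> have "B = H (shift Lb (subtree u))" by simp
      then show ?thesis by (metis UnI1 imageI rangeI)
    qed
  qed
  then have "right_limits \<subseteq> H ` right_limits \<union> (spread ` pair_limits \<union> spread ` pair_limits)"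
    unfolding right_limits_def pair_limits_def
    by (rule limits_Un3[OF _ limits_H limits_spread limits_spread]) auto
  with assms have "D \<in> H ` right_limits \<union> (spread ` pair_limits \<union> spread ` pair_limits)" by (rule subsetD[rotated])
  then show ?thesis by (elim UnE imageE) (rule that; assumption)+
qed

lemma pair_limits_decompose:
  assumes "E \<in> pair_limits"
  obtains (even) E' where "E' \<in> pair_limits" "E = H E'"
  | (twin) D where "D \<in> right_limits" "E = twin 0 D"
  | (spread) E' where "E' \<in> pair_limits" "E = spread E'"
proof -
  have "blank ` orbit \<subseteq> H ` blank ` orbit \<union> (twin 0 ` shift Lb ` orbit \<union> spread ` blank ` orbit)"
  proof
    fix B
    assume "B \<in> blank ` orbit"
    then obtain w where "B = blank (subtree w)" by auto
    then show "B \<in> H ` blank ` orbit \<union> (twin 0 ` shift Lb ` orbit \<union> spread ` blank ` orbit)"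
    proof (cases w rule: subtree_cases)
      case (even u)
      with \<open>B = blank (subtree w)\<close> have "B = H (blank (subtree u))"
        by - (rule tree_eqI, simp_all)
      then show ?thesis by (metis UnI1 imageI rangeI)
    next
      case (odd_a u)
      with \<open>B = blank (subtree w)\<close> have "B = twin 0 (shift Lb (subtree u))"
        by - (rule tree_eqI, simp_all)
      then show ?thesis by (metis UnI1 UnI2 imageI rangeI)
    next
      case (odd_b u)
      with \<open>B = blank (subtree w)\<close> have "B = spread (blank (subtree u))"
        by - (rule tree_eqI, simp_all)
      then show ?thesis by (metis UnI2 imageI rangeI)
    qed
  qed
  then have "pair_limits \<subseteq> H ` pair_limits \<union> (twin 0 ` right_limits \<union> spread ` pair_limits)"
    unfolding right_limits_def pair_limits_def
    by (rule limits_Un3[OF _ limits_H limits_twin limits_spread]) auto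
  with assms have "E \<in> H ` pair_limits \<union> (twin 0 ` right_limits \<union> spread ` pair_limits)" by (rule subsetD[rotated])
  then show ?thesis by (elim UnE imageE) (rule that; assumption)+
qed

lemma child_letter: "shift l A [] = A [l]"
  by (simp add: shift_def)

text \<open>
  Labels \<open>0\<close> and \<open>1\<close> on a left and a right child can come only from the case \<open>odd_b\<close>, which copies these
  labels from a subtree cut at a smaller level.
\<close>
lemma subtree_children: "subtree w [La] = 0 \<Longrightarrow> subtree w [Lb] = 0"
proof (induction w rule: length_induct)
  case (1 w)
  show ?case
  proof (cases w rule: subtree_cases)
    case (odd_a u)
    with 1 show ?thesis by (metis child_letter twin_simps(2))
  next
    case (odd_b u)
    then have "subtree w [l] = subtree u [l]" for l
      by (metis child_letter spread_simps(2) H.simps(1))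
    with 1 odd_b show ?thesis by auto
  qed simp
qed

lemma pair_limits_children: "E \<in> pair_limits \<Longrightarrow> E [La] = 0 \<Longrightarrow> E [Lb] = 0"
proof -
  assume "E \<in> pair_limits" "E [La] = 0"
  moreover from \<open>E \<in> pair_limits\<close> obtain w where "agree 1 E (blank (subtree w))"
    unfolding pair_limits_def limits_def by blast
  then have "E [l] = subtree w [l]" for l
    by (cases l) (simp_all add: agree_def blank_def shift_def)
  ultimately show ?thesis using subtree_children by auto
qed

section \<open>Sibling pairs containing a given tree\<close>

text \<open>
  For a limit \<open>A\<close> of right children the pair \<open>(A, A)\<close> is included by definition: this makes
  \<open>pairs_with_H\<close> an inclusion without exceptional elements, since \<open>(H C, H C)\<close> is then
  always the image of \<open>(C, C)\<close>.
\<close>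
definition pairs_with :: "tree \<Rightarrow> tree set" where
  "pairs_with A = {E \<in> pair_limits. shift La E = A \<or> shift Lb E = A} \<union> (if A \<in> right_limits then {node 0 A A} else {})"

text \<open>
  As agreement up to level \<open>n\<close> is an equivalence relation, this says that it has at most two classes
  on \<open>S\<close>. The form with three elements is preserved by maps without choosing representatives.
\<close>
definition two_classes :: "nat \<Rightarrow> tree set \<Rightarrow> bool" where
  "two_classes n S \<longleftrightarrow> (\<forall>x\<in>S. \<forall>y\<in>S. \<forall>z\<in>S. agree n x y \<or> agree n x z \<or> agree n y z)"

lemma two_classes_image:
  assumes "two_classes m S" "S' \<subseteq> f ` S" "\<And>x y. agree m x y \<Longrightarrow> agree n (f x) (f y)"
  shows "two_classes n S'"
proof -
  have "two_classes n (f ` S)"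
    using assms(1,3) unfolding two_classes_def ball_simps by blast
  with assms(2) show ?thesis unfolding two_classes_def by (meson subsetD)
qed

lemma two_classes_pair: "S \<subseteq> {x, y} \<Longrightarrow> two_classes n S"
  unfolding two_classes_def using agree_refl by blast

lemma card_le_2_if_two_classes:
  assumes S: "\<And>n. two_classes n S"
  shows "finite S \<and> card S \<le> 2"
proof (rule ccontr)
  assume "\<not> (finite S \<and> card S \<le> 2)"
  then have "infinite S \<or> (finite S \<and> 3 \<le> card S)" by auto
  then obtain S' where "S' \<subseteq> S" "card S' = 3"
    by (meson infinite_arbitrarily_large obtain_subset_with_card_n)
  then obtain x y z where xyz: "x \<in> S" "y \<in> S" "z \<in> S" "x \<noteq> y" "x \<noteq> z" "y \<noteq> z"
    by (auto simp: card_3_iff)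
  then obtain u v w where uvw: "x u \<noteq> y u" "x v \<noteq> z v" "y w \<noteq> z w" by (meson ext)
  define n where "n = length u + length v + length w"
  have "length u \<le> n" "length v \<le> n" "length w \<le> n" by (simp_all add: n_def)
  with uvw have "\<not> agree n x y" "\<not> agree n x z" "\<not> agree n y z"
    unfolding agree_def by blast+
  then show False using S[of n] xyz unfolding two_classes_def by blast
qed

lemma pairs_with_H: "pairs_with (H C) \<subseteq> spread ` pairs_with C"
proof
  fix E
  assume E: "E \<in> pairs_with (H C)"
  have doubled: "twin 0 C \<in> spread ` pairs_with C" if "C \<in> right_limits"
  proof -
    have "twin 0 C = spread (node 0 C C)" by (simp add: twin_def spread_def)
    with that show ?thesis by (auto simp: pairs_with_def)
  qed
  from E consider "E = node 0 (H C) (H C)" "H C \<in> right_limits"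
    | "E \<in> pair_limits" "shift La E = H C \<or> shift Lb E = H C"
    by (auto simp: pairs_with_def split: if_splits)
  then show "E \<in> spread ` pairs_with C"
  proof cases
    case 1
    from 1(2) have "C \<in> right_limits"
      by (cases rule: right_limits_decompose) (auto simp: spread_def)
    with doubled 1 show ?thesis by (simp add: twin_def)
  next
    case 2
    from 2(1) show ?thesis
    proof (cases rule: pair_limits_decompose)
      case (even E')
      with 2 show ?thesis by auto
    next
      case (twin D)
      with 2 doubled show ?thesis by auto
    next
      case (spread E')
      with 2 show ?thesis by (auto simp: pairs_with_def)
    qed
  qed
qed

lemma pairs_with_not_H:
  assumes "A \<notin> range H" "E \<in> pair_limits" "shift La E = A \<or> shift Lb E = A"
  obtains E' where "E' \<in> pair_limits" "E = H E'"
  using assms(2) by (cases rule: pair_limits_decompose) (use assms that in auto)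

lemma root_0_child_of_H:
  assumes "E = H C" "shift La E = A \<or> shift Lb E = A" "A [] = 0"
  shows "E = node (E []) (node 1 (shift Lb A) (shift Lb A)) A"
proof -
  from assms have "A = node 0 (H (shift La C)) (H (shift Lb C))" by auto
  with assms(1) show ?thesis using node_collapse[of E] by simp
qed

text \<open>
  The induction descends along the substitution. If \<open>A = H C\<close>, the pairs come from pairs with \<open>C\<close>.
  Otherwise they are, apart from \<open>(A, A)\<close>, images under \<open>H\<close>. If \<open>A\<close> then has root \<open>0\<close>, it occurs only
  as a right child and determines its sibling; if it has root \<open>1\<close> and occurs at all, it is
  \<open>twin 1 F\<close>, and the pairs come from pairs with right member \<open>F\<close>.
\<close>
lemma two_classes_pairs_with: "two_classes n (pairs_with A)"
proof (induction n arbitrary: A)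
  case 0
  have root: "E [] = 0" if "E \<in> pairs_with A" for E
    using that pair_limits_root by (auto simp: pairs_with_def split: if_splits)
  then have "agree 0 E E'" if "E \<in> pairs_with A" "E' \<in> pairs_with A" for E E'
    using root[OF that(1)] root[OF that(2)] by (simp add: agree_def)
  then show ?case unfolding two_classes_def by blast
next
  case (Suc n)
  show ?case
  proof (cases n)
    case 0
    have root: "E [] = 0" if "E \<in> pairs_with A" for E
      using that pair_limits_root by (auto simp: pairs_with_def split: if_splits)
    (* Two siblings have the same root, which is then that of A, or the roots 1 and 0 in this
       order, since the reverse order does not occur. *)
    have ch: "E [La] = A [] \<and> E [Lb] = A [] \<or> E [La] = 1 \<and> E [Lb] = 0"
      if "E \<in> pairs_with A" for E
    proof (cases "E \<in> pair_limits")
      case True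
      with that pair_limits_children[of E] show ?thesis
        by (cases "E [La] = 0"; cases "E [Lb] = 0")
          (auto simp: pairs_with_def child_letter split: if_splits)
    next
      case False
      with that show ?thesis by (auto simp: pairs_with_def split: if_splits)
    qed
    have agree1: "agree 1 E E' \<longleftrightarrow> E [] = E' [] \<and> E [La] = E' [La] \<and> E [Lb] = E' [Lb]" for E E'
    proof -
      have "length w \<le> 1 \<longleftrightarrow> w \<in> {[], [La], [Lb]}" for w
        by (cases w; cases "hd w") auto
      then show ?thesis unfolding agree_def by auto
    qed
    show ?thesis
      unfolding two_classes_def 0 agree1 One_nat_def[symmetric]
    proof (intro ballI)
      fix x y z
      assume E: "x \<in> pairs_with A" "y \<in> pairs_with A" "z \<in> pairs_with A"
      from ch[OF E(1)] ch[OF E(2)] ch[OF E(3)]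
      show "x [] = y [] \<and> x [La] = y [La] \<and> x [Lb] = y [Lb] \<or>
          x [] = z [] \<and> x [La] = z [La] \<and> x [Lb] = z [Lb] \<or>
          y [] = z [] \<and> y [La] = z [La] \<and> y [Lb] = z [Lb]"
        by (elim disjE) (simp_all add: root[OF E(1)] root[OF E(2)] root[OF E(3)])
    qed
  next
    case (Suc m)
    show ?thesis
    proof (cases "A \<in> range H")
      case True
      then obtain C where "A = H C" by blast
      then show ?thesis
        using two_classes_image[OF Suc.IH pairs_with_H] agree_spread Suc by blast
    next
      case False
      show ?thesis
      proof (cases "A [] = 0")
        case True
        have "E = node 0 (node 1 (shift Lb A) (shift Lb A)) A"
          if E: "E \<in> pair_limits" "shift La E = A \<or> shift Lb E = A" for E
        proof -
          obtain E' where "E' \<in> pair_limits" "E = H E'" using pairs_with_not_H[OF False E] .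
          from root_0_child_of_H[of E E' A] this(2) E(2) True pair_limits_root[OF E(1)] show ?thesis by simp
        qed
        then show ?thesis
          by (intro two_classes_pair[of _ "node 0 (node 1 (shift Lb A) (shift Lb A)) A" "node 0 A A"])
             (auto simp: pairs_with_def)
      next
        case root: False
        (* A right child that is not an image of H has root 0, so (A, A) does not count here. *)
        have "A \<notin> right_limits"
        proof
          assume "A \<in> right_limits"
          then show False by (cases rule: right_limits_decompose) (use False root in auto)
        qed
        have lift: "\<exists>E'\<in>pair_limits. E = H E' \<and> A = twin 1 (shift Lb E')" if "E \<in> pairs_with A" for E
        proof -
          from that \<open>A \<notin> right_limits\<close> have E: "E \<in> pair_limits" "shift La E = A \<or> shift Lb E = A"
            by (auto simp: pairs_with_def)
          then obtain E' where "E' \<in> pair_limits" "E = H E'" using pairs_with_not_H[OF False] by metis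
          with E root show ?thesis by (auto simp: twin_def)
        qed
        (* F exists also if A is not of this form, and then it is arbitrary. *)
        obtain F where F: "\<And>D. A = twin 1 D \<Longrightarrow> D = F"
          by (metis H_inject twin_simps(2))
        have "pairs_with A \<subseteq> H ` pairs_with F"
          using lift F by (fastforce simp: pairs_with_def)
        then show ?thesis
          using two_classes_image[OF Suc.IH] agree_H by blast
      qed
    qed
  qed
qed

lemma card_pairs_with: "finite (pairs_with A)" "card (pairs_with A) \<le> 2"
  using card_le_2_if_two_classes two_classes_pairs_with by blast+

section \<open>Counting preimages\<close>

definition parents :: "tree \<Rightarrow> tree set" where
  "parents A = {B \<in> X. shift La B = A \<or> shift Lb B = A}"

lemma parents_H: "finite (parents (H C)) \<and> card (parents (H C)) \<le> 3"
proof -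
  have "parents (H C) \<subseteq> insert (twin 1 C) (spread ` pairs_with C)"
  proof
    fix B
    assume "B \<in> parents (H C)"
    then have B: "B \<in> X" "shift La B = H C \<or> shift Lb B = H C" by (auto simp: parents_def)
    from B(1) show "B \<in> insert (twin 1 C) (spread ` pairs_with C)"
      by (cases rule: X_decompose) (use B(2) in \<open>auto simp: pairs_with_def\<close>)
  qed
  moreover have "card (insert (twin 1 C) (spread ` pairs_with C)) \<le> 3"
    using card_insert_le_m1[of 3] card_image_le[of "pairs_with C" spread] card_pairs_with[of C]
    by (metis (no_types, lifting) One_nat_def diff_Suc_1 le_trans numeral_2_eq_2 numeral_3_eq_3 zero_less_Suc)
  ultimately show ?thesis
    using card_pairs_with[of C] by (meson card_mono finite_imageI finite_insert finite_subset le_trans)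
qed

lemma parents_not_H:
  assumes "A \<notin> range H" "B \<in> parents A"
  obtains C where "C \<in> X" "B = H C"
proof -
  from assms have B: "B \<in> X" "shift La B = A \<or> shift Lb B = A" by (auto simp: parents_def)
  from B(1) show ?thesis
    by (cases rule: X_decompose) (use B(2) assms that in auto)
qed

lemma parents_root_0:
  assumes A: "A \<notin> range H" "A [] = 0"
  shows "finite (parents A) \<and> card (parents A) \<le> 3"
proof -
  let ?B = "\<lambda>i. node i (node 1 (shift Lb A) (shift Lb A)) A"
  have "parents A \<subseteq> ?B ` {0, 1}"
  proof
    fix B
    assume B: "B \<in> parents A"
    obtain C where C: "B = H C" using parents_not_H[OF A(1) B] by blast
    from B have "shift La B = A \<or> shift Lb B = A" by (simp add: parents_def)
    then have "B = ?B (B [])" by (rule root_0_child_of_H[where A = A, OF C _ A(2)])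
    moreover have "B [] \<in> {0, 1}" by (cases "B [] = 0") simp_all
    ultimately show "B \<in> ?B ` {0, 1}" by (rule image_eqI)
  qed
  moreover have "card (?B ` {0, 1}) \<le> 3" by (simp add: card_insert_if)
  ultimately show ?thesis
    by (meson card_mono finite.emptyI finite.insertI finite_imageI finite_subset le_trans)
qed

text \<open>
  The remaining case is that of \<open>A = twin 1 F\<close>, whose parents are of the form \<open>H C\<close> with \<open>F\<close> the right child of
  \<open>C \<in> X\<close>. Being a limit of right children, \<open>F\<close> is an image of \<open>H\<close> or has root \<open>0\<close>, so the reduction
  stops after one step.
\<close>
lemma card_parents: "finite (parents A) \<and> card (parents A) \<le> 3"
proof (cases "A \<in> range H \<or> A [] = 0 \<or> parents A = {}")
  case True
  then show ?thesis using parents_H parents_root_0 by (metis card.empty finite.emptyI image_iff zero_le)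
next
  case False
  have lift: "\<exists>C\<in>X. B = H C \<and> A = twin 1 (shift Lb C)" if B: "B \<in> parents A" for B
  proof -
    obtain C where "C \<in> X" "B = H C" using parents_not_H B False by metis
    with B False show ?thesis by (auto simp: parents_def twin_def)
  qed
  with False obtain C where C: "C \<in> X" "A = twin 1 (shift Lb C)" by blast
  let ?F = "shift Lb C"
  have "?F \<in> right_limits" using shift_Lb_in_right_limits[OF blank_in_pair_limits[OF C(1)]] by simp
  then have F: "finite (parents ?F) \<and> card (parents ?F) \<le> 3"
  proof (cases rule: right_limits_decompose)
    case (even D')
    then show ?thesis using parents_H by simp
  next
    case (spread E)
    then show ?thesis by (intro parents_root_0) (auto simp: spread_def)
  qed
  have "parents A \<subseteq> H ` parents ?F"
  proof
    fix B
    assume "B \<in> parents A"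
    then obtain C' where C': "C' \<in> X" "B = H C'" "A = twin 1 (shift Lb C')" using lift by blast
    with C(2) have "shift Lb C' = ?F" by (metis H_inject twin_simps(2))
    with C' show "B \<in> H ` parents ?F" by (simp add: parents_def)
  qed
  with F show ?thesis
    by (meson card_image_le card_mono finite_imageI finite_subset le_trans)
qed

lemma T_in_X: "B \<in> X \<Longrightarrow> T w B \<in> X"
  by (induction w) (simp_all add: shift_in_X)

lemma preimages_Suc: "preimages (Suc n) A \<subseteq> (\<Union>C\<in>parents A. preimages n C)"
proof
  fix B
  assume "B \<in> preimages (Suc n) A"
  then obtain l w where B: "B \<in> X" "length w = n" "shift l (T w B) = A"
    by (auto simp: preimages_def length_Suc_conv)
  then have "T w B \<in> parents A" using T_in_X by (cases l) (auto simp: parents_def)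
  with B show "B \<in> (\<Union>C\<in>parents A. preimages n C)" by (auto simp: preimages_def)
qed

theorem theorem2:
  fixes A :: tree and n :: nat
  assumes "A \<in> X"
  shows "finite (preimages n A) \<and> p n A \<le> 3 ^ n"
proof -
  have "finite (preimages n A) \<and> card (preimages n A) \<le> 3 ^ n" for A
  proof (induction n arbitrary: A)
    case 0
    have "preimages 0 A \<subseteq> {A}" by (auto simp: preimages_def)
    then show ?case using card_mono[of "{A}"] finite_subset[of _ "{A}"] by force
  next
    case (Suc n)
    have fin: "finite (\<Union>C\<in>parents A. preimages n C)" using Suc card_parents by blast
    have "card (\<Union>C\<in>parents A. preimages n C) \<le> (\<Sum>C\<in>parents A. card (preimages n C))"
      using card_parents by (intro card_UN_le) blast
    also have "\<dots> \<le> card (parents A) * 3 ^ n"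
      using Suc sum_bounded_above[of "parents A" "\<lambda>C. card (preimages n C)" "3 ^ n"] by simp
    also have "\<dots> \<le> 3 ^ Suc n" using card_parents by simp
    finally show ?case using fin preimages_Suc by (meson card_mono finite_subset le_trans)
  qed
  then show ?thesis by (simp add: p_def)
qed

end
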